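(* Every principal minor of the matrix $W_{11}=(u^{ij})_{0\le i,j<11}$ over the field $K_{13}=\mathbb{F}_{13}[X]/(\Phi_{11}(X))$ is nonzero; that is, $\det (u^{ij})_{i,j\in S}\neq 0$ in $K_{13}$ for every $S\subseteq\{0,1,\dots,10\}$.
   Context: Here $\Phi_{11}(X)=1+X+\cdots+X^{10}$, $K_{13}=\mathbb{F}_{13}[X]/(\Phi_{11}(X))$ (a field with $13^{10}$ elements), and $u=X\bmod \Phi_{11}(X)\in K_{13}$ is the class of $X$. The determinant of the empty matrix ($S=\varnothing$) is $1$ by convention. *)

theory Defs
  imports
    "Berlekamp_Zassenhaus.Distinct_Degree_Factorization"
    "Jordan_Normal_Form.Determinant"
    "Jordan_Normal_Form.DL_Submatrix"
begin

text \<open>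
  \<^typ>\<open>'a mod_ring\<close> is the ring of integers modulo the cardinality of its index type,
  and a field when that cardinality is prime; \<open>p13\<close> serves only as an index type with 13 elements.
\<close>

typedef p13 = "{0..<13::nat}"
  by (rule exI[of _ 0]) simp

lemma CARD_p13: "CARD(p13) = 13"
  using type_definition.card[OF type_definition_p13] by simp

instance p13 :: prime_card
proof
  have "prime (13::nat)" by simp
  then show "prime CARD(p13)" by (simp only: CARD_p13)
qed

type_synonym F13 = "p13 mod_ring"

definition Phi11 :: "F13 poly" where
  "Phi11 = (\<Sum>i\<le>10. [:0, 1:] ^ i)"

lemma Phi11_mult: "([:0, 1:] - 1) * Phi11 = [:0, 1:] ^ 11 - 1"
proof -
  have "{..10::nat} = {..<11}" by auto
  then show ?thesis
    unfolding Phi11_def using power_diff_1_eq[of "[:0, 1:] :: F13 poly" 11] by simp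
qed

lemma X_minus_1: "[:0, 1:] - 1 = ([:-1, 1:] :: F13 poly)"
  by (simp only: one_pCons diff_pCons diff_0_right diff_0)

lemma degree_Phi11: "degree Phi11 = 10" and Phi11_nz: "Phi11 \<noteq> 0"
proof -
  have "[:0, 1:] ^ 11 - 1 = (monom 1 11 + - 1 :: F13 poly)"
    by (simp only: x_as_monom x_pow_n diff_conv_add_uminus)
  moreover have "degree (monom 1 11 + - 1 :: F13 poly) = degree (monom 1 11 :: F13 poly)"
    by (rule degree_add_eq_left) (simp add: degree_monom_eq)
  ultimately have deg: "degree ([:0, 1:] ^ 11 - 1 :: F13 poly) = 11"
    by (simp only:) (simp add: degree_monom_eq)
  then show "Phi11 \<noteq> 0"
    using Phi11_mult by (metis degree_0 mult_zero_right zero_neq_numeral)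
  then have "degree ([:-1, 1:] * Phi11) = 1 + degree Phi11"
    by (subst degree_mult_eq) simp_all
  then show "degree Phi11 = 10"
    using deg unfolding Phi11_mult[symmetric] X_minus_1 by linarith
qed

lemma Phi11_at_1: "poly Phi11 1 \<noteq> 0"
proof -
  have "poly Phi11 1 = of_nat 11"
    unfolding Phi11_def by (simp add: poly_sum)
  moreover have "(of_nat 11 :: F13) \<noteq> 0"
    by (simp only: of_nat_eq_0_iff_char_dvd semiring_char_mod_ring CARD_p13) simp
  ultimately show ?thesis by simp
qed

lemma ten_dvd_if_eleven_dvd:
  assumes "11 dvd (13::nat) ^ d - 1"
  shows "10 dvd d"
proof -
  define r where "r = d mod 10"
  have r: "r < 10" by (simp add: r_def)
  have "[13 ^ d = (1::nat)] (mod 11)"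
    using assms by (simp add: cong_altdef_nat)
  moreover have "[13 ^ d = (13 ^ r :: nat)] (mod 11)"
  proof -
    have "(13::nat) ^ d = (13 ^ 10) ^ (d div 10) * 13 ^ r"
      by (simp only: r_def flip: power_mult power_add) simp
    moreover have "[(13 ^ 10) ^ (d div 10) = 1 ^ (d div 10) :: nat] (mod 11)"
      by (intro cong_pow) (simp add: cong_def)
    then have "[(13 ^ 10) ^ (d div 10) * 13 ^ r = 1 * 13 ^ r :: nat] (mod 11)"
      by (intro cong_mult) simp_all
    ultimately show ?thesis by simp
  qed
  ultimately have "(13::nat) ^ r mod 11 = 1" by (simp add: cong_def)
  moreover have "r \<in> {0, 1, 2, 3, 4, 5, 6, 7, 8, 9}" using r by auto
  ultimately have "r = 0" by auto
  then show ?thesis by (simp add: r_def mod_eq_0_iff_dvd)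
qed

lemma irreducible_Phi11: "irreducible Phi11"
proof -
  let ?X = "[:0, 1:] :: F13 poly"
  have "\<not> is_unit Phi11" by (simp add: is_unit_iff_degree Phi11_nz degree_Phi11)
  then obtain g where g: "prime_elem g" "g dvd Phi11"
    using prime_divisor_exists[of Phi11] Phi11_nz by auto
  then have irr: "irreducible g" by (simp add: prime_elem_imp_irreducible)
  define d where "d = degree g"
  have "g \<noteq> 0" "\<not> is_unit g" using g(1) unfolding prime_elem_def by blast+
  then have d: "d > 0" by (metis d_def gr0I is_unit_iff_degree)
  have "g dvd ?X ^ 11 - 1" using g(2) Phi11_mult by (metis dvd_mult)
  then have X11: "[?X ^ 11 = 1] (mod g)" by (simp add: cong_iff_dvd_diff)
  have not_dvd_X: "\<not> g dvd ?X"
  proof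
    assume "g dvd ?X"
    then have "g dvd ?X ^ 11" by (rule dvd_trans) (simp add: dvd_power)
    with \<open>g dvd ?X ^ 11 - 1\<close> have "g dvd 1" by (metis dvd_diff_right_iff)
    with g(1) show False unfolding prime_elem_def by blast
  qed
  have not_dvd_X1: "\<not> g dvd ?X - 1"
  proof
    assume "g dvd ?X - 1"
    then obtain h where h: "[:-1, 1:] = g * h" unfolding X_minus_1 by (rule dvdE)
    then have "g \<noteq> 0" "h \<noteq> 0" by auto
    then have "degree g + degree h = 1" using arg_cong[OF h, of degree] by (simp add: degree_mult_eq)
    then have "degree h = 0" using d by (simp add: d_def)
    then have "poly h 1 \<noteq> 0" using \<open>h \<noteq> 0\<close> by (metis degree_eq_zeroE poly_const_conv pCons_0_0)
    moreover have "poly g 1 * poly h 1 = 0" by (simp flip: poly_mult h)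
    ultimately have "poly g 1 = 0" by simp
    then show False using g(2) Phi11_at_1 by (metis dvd_def mult_zero_left poly_mult)
  qed
  define N where "N = (13::nat) ^ d - 1"
  have "g dvd ?X ^ (13 ^ d) - ?X"
    using degree_divisor1[OF irr d_def[symmetric]] by (simp only: CARD_p13 x_as_monom)
  moreover have "?X ^ (13 ^ d) - ?X = ?X * (?X ^ N - 1)"
  proof -
    have "(13::nat) ^ d = Suc N" by (simp add: N_def)
    then show ?thesis by (simp only: power_Suc right_diff_distrib mult_1_right)
  qed
  ultimately have "g dvd ?X * (?X ^ N - 1)" by (simp only:)
  then have "g dvd ?X ^ N - 1"
    using prime_elem_dvd_multD[OF g(1)] not_dvd_X by metis
  then have XN: "[?X ^ N = 1] (mod g)" by (simp add: cong_iff_dvd_diff)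
  have "11 dvd N"
  proof (rule ccontr)
    assume "\<not> 11 dvd N"
    moreover have "prime (11::nat)" by simp
    ultimately have "coprime N 11" 
      using prime_imp_coprime[of 11 N] by (simp add: ac_simps)
    then obtain s where "[N * s = 1] (mod 11)" using cong_solve_coprime_nat[of N 11] by auto
    then obtain k1 k2 where k: "1 + k1 * 11 = N * s + k2 * 11" by (auto simp: cong_iff_lin_nat)
    have Xs: "[?X ^ (N * s) = 1] (mod g)"
      using cong_pow[OF XN, of s] by (simp only: power_mult power_one)
    have Xk: "[?X ^ (k * 11) = 1] (mod g)" for k
      using cong_pow[OF X11, of k] by (simp only: power_mult power_one mult.commute[of k])
    have "[?X ^ (1 + k1 * 11) = ?X * 1] (mod g)"
      unfolding power_add power_one_right by (intro cong_mult cong_refl Xk)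
    moreover have "[?X ^ (1 + k1 * 11) = 1 * 1] (mod g)"
      unfolding k power_add by (intro cong_mult Xs Xk)
    ultimately have "[?X = 1] (mod g)"
      unfolding mult_1_right by (rule cong_trans[OF cong_sym])
    then show False using not_dvd_X1 by (simp add: cong_iff_dvd_diff)
  qed
  then have "10 dvd d" by (simp add: N_def ten_dvd_if_eleven_dvd)
  then have "10 \<le> degree g" using d by (auto simp: d_def dest: dvd_imp_le)
  obtain h where h: "Phi11 = g * h" using g(2) by (rule dvdE)
  with Phi11_nz have "g \<noteq> 0" "h \<noteq> 0" by auto
  then have "degree g + degree h = 10" using h degree_Phi11 by (metis degree_mult_eq)
  with \<open>10 \<le> degree g\<close> have "degree h = 0" by simp
  then have "is_unit h" using \<open>h \<noteq> 0\<close> by (simp add: is_unit_iff_degree)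
  with irr show ?thesis
    unfolding h using irreducible_mult_unit_left[of h g] by (simp only: mult.commute[of g])
qed

text \<open>The field \<open>F13[X] / (Phi11)\<close>, as congruence classes modulo the ideal generated by \<open>Phi11\<close>.\<close>

quotient_type K13 = "F13 poly" / "\<lambda>f g. Phi11 dvd f - g"
proof (rule equivpI)
  show "reflp (\<lambda>f g. Phi11 dvd f - g)" by (simp add: reflp_def)
  show "symp (\<lambda>f g. Phi11 dvd f - g)" by (simp add: symp_def dvd_diff_commute)
  show "transp (\<lambda>f g. Phi11 dvd f - g)"
  proof (rule transpI)
    fix f g h :: "F13 poly"
    assume "Phi11 dvd f - g" "Phi11 dvd g - h"
    then have "Phi11 dvd (f - g) + (g - h)" by (rule dvd_add)
    then show "Phi11 dvd f - h" by simp
  qed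
qed

instantiation K13 :: comm_ring_1
begin

lift_definition zero_K13 :: K13 is 0 .
lift_definition one_K13 :: K13 is 1 .

lift_definition plus_K13 :: "K13 \<Rightarrow> K13 \<Rightarrow> K13" is "(+)"
  by (simp add: add_diff_add)

lift_definition minus_K13 :: "K13 \<Rightarrow> K13 \<Rightarrow> K13" is "(-)"
proof -
  fix a b c d :: "F13 poly"
  assume "Phi11 dvd a - b" "Phi11 dvd c - d"
  then have "Phi11 dvd (a - b) - (c - d)" by (rule dvd_diff)
  then show "Phi11 dvd (a - c) - (b - d)" by (simp add: algebra_simps)
qed

lift_definition uminus_K13 :: "K13 \<Rightarrow> K13" is uminus
  by (metis dvd_diff_commute minus_diff_minus dvd_minus_iff)

lift_definition times_K13 :: "K13 \<Rightarrow> K13 \<Rightarrow> K13" is "(*)"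
proof -
  fix a b c d :: "F13 poly"
  assume "Phi11 dvd a - b" "Phi11 dvd c - d"
  then have "Phi11 dvd (a - b) * c + b * (c - d)" by simp
  then show "Phi11 dvd a * c - b * d" by (simp add: algebra_simps)
qed

instance
proof
  show "(0::K13) \<noteq> 1"
  proof (transfer, rule notI)
    assume "Phi11 dvd 0 - 1"
    then have "degree Phi11 = 0" using poly_dvd_1 by (metis diff_0 dvd_minus_iff)
    then show False by (simp add: degree_Phi11)
  qed
qed (transfer, simp add: algebra_simps)+

end

instantiation K13 :: field
begin

definition inverse_K13 :: "K13 \<Rightarrow> K13" where
  "inverse_K13 x = (if x = 0 then 0 else (THE y. x * y = 1))"

definition divide_K13 :: "K13 \<Rightarrow> K13 \<Rightarrow> K13" where
  "divide_K13 x y = x * inverse y"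

instance
proof
  fix x y :: K13
  assume nz: "x \<noteq> 0"
  have "\<exists>y. x * y = 1"
    using nz
  proof transfer
    fix f
    assume "\<not> Phi11 dvd f - 0"
    then have "gcd Phi11 f = 1"
      using irreducible_Phi11
      by (intro coprime_imp_gcd_eq_1 prime_elem_imp_coprime) (simp_all add: irreducible_imp_prime_elem)
    then obtain a b where "a * Phi11 + b * f = 1"
      using bezout_coefficients_fst_snd[of Phi11 f] by auto
    then have "f * b - 1 = Phi11 * (- a)" by (simp add: algebra_simps)
    then have "Phi11 dvd f * b - 1" by (rule dvdI)
    then show "\<exists>b. Phi11 dvd f * b - 1" by blast
  qed
  then obtain z where z: "x * z = 1" by blast
  have "(THE y. x * y = 1) = z"
  proof (rule the_equality[where P = "\<lambda>y. x * y = 1"])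
    fix w assume "x * w = 1"
    then show "w = z" using z by (metis mult.assoc mult.commute mult_1_left)
  qed (fact z)
  then show "inverse x * x = 1"
    using z nz by (simp add: inverse_K13_def mult.commute)
qed (simp_all add: inverse_K13_def divide_K13_def)

end

lift_definition u :: K13 is "[:0, 1:]" .

definition W11 :: "K13 mat" where
  "W11 = mat 11 11 (\<lambda>(i, j). u ^ (i * j))"

end

theory Submission
  imports Defs "HOL-Library.Code_Binary_Nat"
begin

text \<open>
  The principal minor on \<open>S\<close> vanishes iff some nonzero \<open>v\<close> supported on \<open>S\<close> has a transform
  \<open>i \<mapsto> \<Sum>j. u ^ (a * i * j) * v j\<close> (with \<open>a = 1\<close>) that vanishes on \<open>S\<close>. An affine change of the
  indices mod 11 turns this into the same condition on the affine image of \<open>S\<close> with another \<open>a\<close>,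
  and Fourier inversion turns it into the condition on the complement of \<open>S\<close> with \<open>- a\<close> for \<open>a\<close>.
  Hence \<open>S\<close> may be taken to have at most five elements and, if it has at least two, to contain 0
  and 1. The minor is then an integer combination of the powers \<open>u ^ (a * k)\<close> with \<open>k < 11\<close>. As
  \<open>Phi11\<close> has degree 10 and all coefficients 1, such a combination vanishes iff its coefficients are
  all congruent mod 13. These do not depend on \<open>a\<close>, and they are computed for the 130 remaining sets.
\<close>

section \<open>Powers of \<open>u\<close> and linear relations between them\<close>

lemma u_eq: "u = abs_K13 [:0, 1:]"
  by (fact u.abs_eq)

lemma abs_K13_power: "abs_K13 (f ^ n) = abs_K13 f ^ n"
  by (induction n) (simp_all add: one_K13.abs_eq flip: times_K13.abs_eq)

lemma abs_K13_sum: "abs_K13 (sum f A) = (\<Sum>x\<in>A. abs_K13 (f x))"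
  by (induction A rule: infinite_finite_induct) (simp_all add: zero_K13.abs_eq flip: plus_K13.abs_eq)

lemma abs_K13_of_nat: "abs_K13 (of_nat n) = of_nat n"
  by (induction n) (simp_all add: zero_K13.abs_eq one_K13.abs_eq flip: plus_K13.abs_eq)

lemma abs_K13_of_int: "abs_K13 (of_int c) = of_int c"
  by (cases c rule: int_cases2) (simp_all add: abs_K13_of_nat flip: uminus_K13.abs_eq)

lemma abs_K13_eq_0_iff: "abs_K13 f = 0 \<longleftrightarrow> Phi11 dvd f"
  by (simp add: zero_K13.abs_eq K13.abs_eq_iff)

lemma u_pow_11: "u ^ 11 = 1"
proof -
  have "Phi11 dvd [:0, 1:] ^ 11 - 1"
    using Phi11_mult by (metis dvd_triv_right)
  then show ?thesis
    by (simp only: u_eq one_K13.abs_eq K13.abs_eq_iff flip: abs_K13_power)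
qed

lemma u_nz: "u \<noteq> 0"
  using u_pow_11 by (metis power_0_left zero_neq_numeral zero_neq_one)

lemma u_pow_cong:
  assumes "[m = n] (mod 11)"
  shows "u ^ m = u ^ n"
proof -
  have "u ^ k = u ^ (k mod 11)" for k
  proof -
    have "u ^ k = u ^ (11 * (k div 11) + k mod 11)" by simp
    then show ?thesis by (simp only: power_add power_mult u_pow_11 power_one mult_1_left)
  qed
  with assms show ?thesis unfolding cong_def by metis
qed

lemma coeff_Phi11: "k < 11 \<Longrightarrow> coeff Phi11 k = 1"
  unfolding Phi11_def by (simp only: x_as_monom x_pow_n coeff_sum coeff_monom) simp

lemma of_int_F13_eq_0_iff: "(of_int c :: F13) = 0 \<longleftrightarrow> 13 dvd c"
  by (simp add: of_int_eq_0_iff_char_dvd CARD_p13)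

text \<open>A polynomial of degree at most 10 divisible by \<open>Phi11\<close> is a constant
  multiple of it, and all coefficients of \<open>Phi11\<close> are 1.\<close>

lemma coeffs_cong_if_relation_u:
  fixes c :: "nat \<Rightarrow> int"
  assumes "(\<Sum>k<11. of_int (c k) * u ^ k) = 0" and "k < 11"
  shows "13 dvd c k - c 0"
proof -
  define P :: "F13 poly" where "P = (\<Sum>k<11. of_int (c k) * [:0, 1:] ^ k)"
  have "abs_K13 P = 0"
    unfolding P_def abs_K13_sum using assms(1)
    by (simp add: abs_K13_of_int abs_K13_power u_eq flip: times_K13.abs_eq)
  then obtain q where q: "P = Phi11 * q"
    unfolding abs_K13_eq_0_iff by (rule dvdE)
  have P: "P = (\<Sum>k<11. monom (of_int (c k)) k)"
    unfolding P_def by (intro sum.cong refl) (simp only: x_as_monom x_pow_n of_int_poly, simp add: smult_monom)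
  then have coeff_P: "coeff P j = of_int (c j)" if "j < 11" for j
    using that by (simp add: coeff_sum)
  have "degree P \<le> 10"
    unfolding P by (intro degree_sum_le) (auto intro: order_trans[OF degree_monom_le])
  then have "degree q = 0"
    using q degree_Phi11 Phi11_nz by (cases "q = 0") (auto simp: degree_mult_eq)
  then obtain b where "q = [:b:]" by (rule degree_eq_zeroE)
  then have "coeff P j = b" if "j < 11" for j
    using that by (simp add: q coeff_Phi11)
  then have "(of_int (c k) :: F13) = of_int (c 0)"
    using coeff_P assms(2) by (metis zero_less_numeral)
  then have "(of_int (c k - c 0) :: F13) = 0" by simp
  then show ?thesis by (simp only: of_int_F13_eq_0_iff)
qed

text \<open>With \<open>r\<close> the residue of \<open>m\<close>, \<open>u ^ r = 1\<close> would be
  a relation with the coefficients 1 and -1, which differ mod 13.\<close>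

lemma u_power_ne_1:
  assumes "\<not> 11 dvd m"
  shows "u ^ m \<noteq> 1"
proof
  define r where "r = m mod 11"
  have r: "r < 11" "r \<noteq> 0" using assms by (auto simp: r_def dvd_eq_mod_eq_0)
  define c :: "nat \<Rightarrow> int" where "c k = (if k = r then 1 else 0) - (if k = 0 then 1 else 0)" for k
  assume "u ^ m = 1"
  then have "u ^ r = 1" using u_pow_cong[of m r] by (simp add: r_def)
  moreover have "(\<Sum>k<11. of_int (c k) * u ^ k) = u ^ r - 1"
    using r by (simp add: c_def left_diff_distrib sum_subtractf if_distrib[of of_int] 
      if_distrib[of "\<lambda>x. x * _"] cong: if_cong)
  ultimately have "13 dvd c r - c 0"
    using r by (intro coeffs_cong_if_relation_u) simp_all
  then show False using r by (simp add: c_def)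
qed

text \<open>Orthogonality of characters mod 11, used for Fourier inversion.\<close>

lemma sum_u_powers:
  "(\<Sum>i<11. u ^ (i * m)) = (if 11 dvd m then 11 else 0)"
proof (cases "11 dvd m")
  case True
  then have "u ^ (i * m) = 1" for i
    using u_pow_cong[of "i * m" 0] by (simp add: cong_0_iff)
  with True show ?thesis by simp
next
  case False
  have "(u ^ m - 1) * (\<Sum>i<11. (u ^ m) ^ i) = (u ^ m) ^ 11 - 1"
    by (rule power_diff_1_eq[symmetric])
  also have "\<dots> = 0" using u_pow_cong[of "m * 11" 0] by (simp add: cong_0_iff flip: power_mult)
  finally show ?thesis using False u_power_ne_1 by (simp add: mult.commute[of _ m] power_mult)
qed

text \<open>Fourier inversion has to cancel the factor 11.\<close>

lemma eleven_ne_0_K13: "(11 :: K13) \<noteq> 0"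
proof
  define c :: "nat \<Rightarrow> int" where "c k = (if k = 0 then 11 else 0)" for k
  assume "(11 :: K13) = 0"
  then have "(\<Sum>k<11. of_int (c k) * u ^ k) = 0"
    by (intro sum.neutral) (simp add: c_def)
  then have "13 dvd c 1 - c 0"
    by (rule coeffs_cong_if_relation_u) simp
  then show False by (simp add: c_def)
qed

section \<open>Kernel vectors and symmetries of index sets\<close>

text \<open>Sums over a set, rather than a matrix, make reindexing independent of any order. The
  parameter \<open>a\<close> is there because the symmetries replace \<open>u\<close> by other
  powers of it.\<close>

definition singular_on :: "nat \<Rightarrow> nat set \<Rightarrow> bool" where
  "singular_on a S \<longleftrightarrow>
    (\<exists>v. (\<exists>i\<in>S. v i \<noteq> 0) \<and> (\<forall>i\<in>S. (\<Sum>j\<in>S. u ^ (a * i * j) * v j) = 0))"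

lemma mult_mod_11_eq_iff:
  fixes c i j :: nat
  assumes "\<not> 11 dvd c"
  shows "(c * i + b) mod 11 = (c * j + b) mod 11 \<longleftrightarrow> i mod 11 = j mod 11"
proof -
  have "coprime c 11"
    using assms prime_imp_coprime[of 11 c] by (simp add: ac_simps)
  then show ?thesis
    by (simp add: cong_add_rcancel_nat cong_mult_lcancel_nat flip: cong_def)
qed

text \<open>In \<open>(c * i + b) * (c * j + b)\<close> every term but the one in
  \<open>i * j\<close> depends on at most one of \<open>i\<close> and \<open>j\<close>, so it only
  rescales rows or columns by powers of \<open>u\<close>.\<close>

lemma singular_on_affine_image:
  assumes S: "S = (\<lambda>t. (c * t + b) mod 11) ` T" and T: "T \<subseteq> {..<11}"
    and c: "\<not> 11 dvd c" and sing: "singular_on a S"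
  shows "singular_on (a * c\<^sup>2) T"
proof -
  define f where "f t = (c * t + b) mod 11" for t
  have S: "S = f ` T" by (simp add: S f_def)
  have "inj_on f T"
  proof (rule inj_onI)
    fix i j assume ij: "i \<in> T" "j \<in> T" "f i = f j"
    then have "i mod 11 = j mod 11" using mult_mod_11_eq_iff[OF c] by (simp add: f_def)
    moreover have "i < 11" "j < 11" using T ij by auto
    ultimately show "i = j" by simp
  qed
  from sing obtain v where v: "\<exists>i\<in>S. v i \<noteq> 0"
      "\<And>i. i \<in> S \<Longrightarrow> (\<Sum>j\<in>S. u ^ (a * i * j) * v j) = 0"
    unfolding singular_on_def by blast
  \<comment> \<open>The column factor moves into the vector; the row factor is nonzero and
    cancels.\<close>
  define w where "w t = u ^ (a * c * b * t) * v (f t)" for t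
  have "(\<Sum>j\<in>T. u ^ (a * c\<^sup>2 * i * j) * w j) = 0" if "i \<in> T" for i
  proof -
    have expo: "u ^ (a * f i * f j) = u ^ (a * c * b * i + a * b * b) * (u ^ (a * c\<^sup>2 * i * j) * u ^ (a * c * b * j))" for j
    proof -
      have "[a * f i * f j = a * (c * i + b) * (c * j + b)] (mod 11)"
        unfolding f_def by (intro cong_mult cong_refl) (simp_all add: cong_def)
      then have "u ^ (a * f i * f j) = u ^ (a * (c * i + b) * (c * j + b))"
        by (rule u_pow_cong)
      also have "a * (c * i + b) * (c * j + b) = (a * c * b * i + a * b * b) + (a * c\<^sup>2 * i * j + a * c * b * j)"
        by (simp add: algebra_simps power2_eq_square)
      finally show ?thesis by (simp only: power_add)
    qed
    have "0 = (\<Sum>j\<in>S. u ^ (a * f i * j) * v j)"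
      using v(2) that S by simp
    also have "\<dots> = (\<Sum>j\<in>T. u ^ (a * f i * f j) * v (f j))"
      unfolding S by (rule sum.reindex_cong[OF \<open>inj_on f T\<close>]) simp_all
    also have "\<dots> = u ^ (a * c * b * i + a * b * b) * (\<Sum>j\<in>T. u ^ (a * c\<^sup>2 * i * j) * w j)"
      unfolding w_def sum_distrib_left expo by (simp only: mult.assoc)
    finally show ?thesis using u_nz by simp
  qed
  moreover have "\<exists>i\<in>T. w i \<noteq> 0"
    using v(1) u_nz unfolding S w_def by auto
  ultimately show ?thesis unfolding singular_on_def by blast
qed

text \<open>The factor 10 is \<open>- 1\<close> mod 11.\<close>

lemma singular_on_compl:
  assumes "singular_on a S" and S: "S \<subseteq> {..<11}" and a: "\<not> 11 dvd a"
  shows "singular_on (10 * a) ({..<11} - S)"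
proof -
  from assms(1) obtain v0 where v0: "\<exists>i\<in>S. v0 i \<noteq> 0"
      "\<And>i. i \<in> S \<Longrightarrow> (\<Sum>j\<in>S. u ^ (a * i * j) * v0 j) = 0"
    unfolding singular_on_def by blast
  \<comment> \<open>The transform \<open>w\<close> of \<open>v0\<close> extended by zero is the
    kernel vector sought: it vanishes on \<open>S\<close>, and transforming it back gives
    \<open>11 * v\<close>, which is zero off \<open>S\<close>.\<close>
  define v where "v j = (if j \<in> S then v0 j else 0)" for j
  define w where "w i = (\<Sum>j<11. u ^ (a * i * j) * v j)" for i
  have w_S: "w i = 0" if "i \<in> S" for i
  proof -
    have "w i = (\<Sum>j\<in>S. u ^ (a * i * j) * v0 j)"
      unfolding w_def by (rule sum.mono_neutral_cong_right) (use S in \<open>auto simp: v_def\<close>)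
    then show ?thesis using v0(2) that by simp
  qed
  have inv: "(\<Sum>i\<in>{..<11} - S. u ^ (10 * a * k * i) * w i) = 11 * v k" if k: "k < 11" for k
  proof -
    have dvd: "11 dvd 10 * a * k + a * j \<longleftrightarrow> j = k" if "j < 11" for j
    proof -
      have "11 dvd 10 * a * k + a * j \<longleftrightarrow> 11 dvd a * (10 * k + j)"
        by (simp add: algebra_simps)
      also have "\<dots> \<longleftrightarrow> 11 dvd 10 * k + j"
        using a by (subst prime_dvd_mult_iff) simp_all
      also have "\<dots> \<longleftrightarrow> [10 * k + j = 10 * k + k] (mod 11)"
        by (simp add: cong_def dvd_eq_mod_eq_0)
      also have "\<dots> \<longleftrightarrow> [j = k] (mod 11)"
        by (rule cong_add_lcancel_nat)
      also have "\<dots> \<longleftrightarrow> j = k"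
        using that k by (simp add: cong_def)
      finally show ?thesis .
    qed
    have "(\<Sum>i\<in>{..<11} - S. u ^ (10 * a * k * i) * w i) = (\<Sum>i<11. u ^ (10 * a * k * i) * w i)"
      by (rule sum.mono_neutral_left) (auto simp: w_S)
    also have "\<dots> = (\<Sum>i<11. \<Sum>j<11. u ^ (i * (10 * a * k + a * j)) * v j)"
    proof -
      have "u ^ (10 * a * k * i) * (u ^ (a * i * j) * v j) = u ^ (i * (10 * a * k + a * j)) * v j" for i j
      proof -
        have "i * (10 * a * k + a * j) = 10 * a * k * i + a * i * j" by (simp add: algebra_simps)
        then show ?thesis by (simp only: power_add mult.assoc)
      qed
      then show ?thesis unfolding w_def sum_distrib_left by (simp only:)
    qed
    also have "\<dots> = (\<Sum>j<11. (\<Sum>i<11. u ^ (i * (10 * a * k + a * j))) * v j)"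
      by (subst sum.swap) (simp add: sum_distrib_right)
    also have "\<dots> = (\<Sum>j<11. if j = k then 11 * v j else 0)"
      unfolding sum_u_powers by (intro sum.cong refl) (simp add: dvd)
    finally show ?thesis using k by simp
  qed
  have "\<exists>i\<in>{..<11} - S. w i \<noteq> 0"
  proof (rule ccontr)
    assume "\<not> ?thesis"
    then have "11 * v k = 0" if "k < 11" for k
      using inv[OF that] by simp
    then show False
      using v0(1) S eleven_ne_0_K13 by (metis lessThan_iff mult_eq_0_iff subsetD v_def)
  qed
  moreover have "(\<Sum>i\<in>{..<11} - S. u ^ (10 * a * k * i) * w i) = 0" if "k \<in> {..<11} - S" for k
    using inv[of k] that by (simp add: v_def)
  ultimately show ?thesis unfolding singular_on_def by blast
qed

section \<open>Principal minors and their kernels\<close>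

text \<open>Rows and columns have separate lists because the minors in a Laplace expansion need not
  be principal.\<close>

definition power_mat :: "nat \<Rightarrow> nat list \<Rightarrow> nat list \<Rightarrow> K13 mat" where
  "power_mat a rs cs = mat (length rs) (length cs) (\<lambda>(i, j). u ^ (a * rs ! i * cs ! j))"

text \<open>Distinctness makes \<open>(!) xs\<close> a bijection from positions to indices, which
  translates kernel vectors into functions on \<open>set xs\<close> and back.\<close>

lemma det_power_mat_eq_0_iff:
  assumes "distinct xs"
  shows "det (power_mat a xs xs) = 0 \<longleftrightarrow> singular_on a (set xs)"
proof -
  define n where "n = length xs"
  have carrier: "power_mat a xs xs \<in> carrier_mat n n"
    by (simp add: power_mat_def n_def)
  have bij: "bij_betw ((!) xs) {..<n} (set xs)"
    using assms by (simp add: n_def bij_betw_nth)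
  have entry: "(power_mat a xs xs *\<^sub>v v) $ i = (\<Sum>j\<in>set xs. u ^ (a * xs ! i * j) * w j)"
    if "i < n" "v \<in> carrier_vec n" "\<And>j. j < n \<Longrightarrow> v $ j = w (xs ! j)" for v w i
  proof -
    have "(power_mat a xs xs *\<^sub>v v) $ i = (\<Sum>j<n. u ^ (a * xs ! i * xs ! j) * w (xs ! j))"
      using that by (simp add: power_mat_def n_def scalar_prod_def atLeast0LessThan)
    also have "\<dots> = (\<Sum>j\<in>set xs. u ^ (a * xs ! i * j) * w j)"
      by (rule sum.reindex_bij_betw[OF bij])
    finally show ?thesis .
  qed
  show ?thesis
    unfolding det_0_iff_vec_prod_zero[OF carrier]
  proof
    assume "\<exists>v. v \<in> carrier_vec n \<and> v \<noteq> 0\<^sub>v n \<and> power_mat a xs xs *\<^sub>v v = 0\<^sub>v n"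
    then obtain v where v: "v \<in> carrier_vec n" "v \<noteq> 0\<^sub>v n" "power_mat a xs xs *\<^sub>v v = 0\<^sub>v n"
      by blast
    define w where "w i = v $ (the_inv_into {..<n} ((!) xs) i)" for i
    have w: "v $ j = w (xs ! j)" if "j < n" for j
      unfolding w_def using that bij by (subst the_inv_into_f_f) (auto simp: bij_betw_def)
    from v(1,2) obtain i where "i < n" "v $ i \<noteq> 0"
      by (metis eq_vecI carrier_vecD index_zero_vec)
    then have "\<exists>i\<in>set xs. w i \<noteq> 0"
      using w by (metis n_def nth_mem)
    moreover have "(\<Sum>j\<in>set xs. u ^ (a * i * j) * w j) = 0" if i: "i \<in> set xs" for i
    proof -
      obtain k where k: "k < n" "i = xs ! k"
        using i unfolding n_def by (metis in_set_conv_nth)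
      show ?thesis using entry[OF k(1) v(1) w] v(3) k by simp
    qed
    ultimately show "singular_on a (set xs)" unfolding singular_on_def by blast
  next
    assume "singular_on a (set xs)"
    then obtain w where w: "\<exists>i\<in>set xs. w i \<noteq> 0"
        "\<And>i. i \<in> set xs \<Longrightarrow> (\<Sum>j\<in>set xs. u ^ (a * i * j) * w j) = 0"
      unfolding singular_on_def by blast
    define v where "v = vec n (\<lambda>j. w (xs ! j))"
    have v: "v \<in> carrier_vec n" "\<And>j. j < n \<Longrightarrow> v $ j = w (xs ! j)"
      by (simp_all add: v_def)
    obtain k where "k < n" "w (xs ! k) \<noteq> 0"
      using w(1) unfolding n_def by (metis in_set_conv_nth)
    then have "v \<noteq> 0\<^sub>v n" using v(2) by (metis index_zero_vec(1))
    moreover have "power_mat a xs xs *\<^sub>v v = 0\<^sub>v n"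
    proof (rule eq_vecI)
      fix i assume "i < dim_vec (0\<^sub>v n :: K13 vec)"
      then have i: "i < n" by simp
      show "(power_mat a xs xs *\<^sub>v v) $ i = 0\<^sub>v n $ i"
        using entry[OF i v] w(2)[of "xs ! i"] i by (simp add: n_def)
    qed (simp add: power_mat_def n_def)
    ultimately show "\<exists>v. v \<in> carrier_vec n \<and> v \<noteq> 0\<^sub>v n \<and> power_mat a xs xs *\<^sub>v v = 0\<^sub>v n"
      using v(1) by blast
  qed
qed

lemma submatrix_W11_eq_power_mat:
  assumes S: "S \<subseteq> {..<11}"
  obtains xs where "distinct xs" "set xs = S" "submatrix W11 S S = power_mat 1 xs xs"
proof -
  define xs where "xs = map (pick S) [0..<card S]"
  have "finite S" using S by (rule finite_subset) simp
  have "i \<in> set xs" if "i \<in> S" for i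
  proof -
    \<comment> \<open>The position at which \<open>i\<close> is picked is the number of smaller
      elements of \<open>S\<close>.\<close>
    have "card {a \<in> S. a < i} < card S"
      by (rule psubset_card_mono[OF \<open>finite S\<close>]) (use that in auto)
    then show ?thesis
      using pick_card_in_set[OF that] unfolding xs_def by (force simp: image_iff)
  qed
  then have set_xs: "set xs = S"
    by (auto simp: xs_def pick_in_set_le)
  moreover have "distinct xs"
    by (rule card_distinct) (simp add: set_xs, simp add: xs_def)
  moreover have "submatrix W11 S S = power_mat 1 xs xs"
  proof -
    have [simp]: "{i. i < 11 \<and> i \<in> S} = S" using S by auto
    have "pick S i < 11" if "i < card S" for i
      using pick_in_set_le[OF that] S by auto
    then show ?thesis
      by (intro eq_matI) (simp_all add: submatrix_def power_mat_def W11_def xs_def)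
  qed
  ultimately show thesis using that by blast
qed

section \<open>Determinants as lists of signed powers\<close>

text \<open>
  Laplace expansion of the determinant with entries \<open>x ^ (r * c)\<close>, where a pair \<open>(s, e)\<close> stands for
  the term \<open>s * x ^ e\<close>. In \<open>expand_row\<close> the columns already passed are collected in \<open>ds\<close>.
\<close>

fun minor_terms :: "nat list \<Rightarrow> nat list \<Rightarrow> (int \<times> nat) list"
  and expand_row :: "int \<Rightarrow> nat \<Rightarrow> nat list \<Rightarrow> nat list \<Rightarrow> nat list \<Rightarrow> (int \<times> nat) list"
where
  "minor_terms [] cs = [(1, 0)]"
| "minor_terms (r # rs) cs = expand_row 1 r rs [] cs"
| "expand_row s r rs ds [] = []"
| "expand_row s r rs ds (c # cs) =
    map (\<lambda>(t, e). (s * t, r * c + e)) (minor_terms rs (ds @ cs))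
      @ expand_row (- s) r rs (ds @ [c]) cs"

text \<open>Only this evaluation, at \<open>x = u ^ a\<close>, involves \<open>a\<close>.\<close>

definition terms_value :: "nat \<Rightarrow> (int \<times> nat) list \<Rightarrow> K13" where
  "terms_value a ts = (\<Sum>(s, e)\<leftarrow>ts. of_int s * u ^ (a * e))"

lemma terms_value_simps [simp]:
  "terms_value a [] = 0"
  "terms_value a ((s, e) # ts) = of_int s * u ^ (a * e) + terms_value a ts"
  "terms_value a (ts @ ts') = terms_value a ts + terms_value a ts'"
  by (simp_all add: terms_value_def)

lemma terms_value_scale:
  "terms_value a (map (\<lambda>(t, e). (s * t, m + e)) ts) = of_int s * u ^ (a * m) * terms_value a ts"
  by (induction ts) (auto simp: algebra_simps power_add)

text \<open>Induction on the remaining columns peels off \<open>j = 0\<close>. Passing a column to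
  \<open>ds\<close> negates \<open>s\<close>, which yields the alternating sign.\<close>

lemma terms_value_expand_row:
  "terms_value a (expand_row s r rs ds cs) =
    (\<Sum>j<length cs. of_int s * (- 1) ^ j * u ^ (a * r * cs ! j) *
      terms_value a (minor_terms rs (ds @ take j cs @ drop (Suc j) cs)))"
proof (induction cs arbitrary: s ds)
  case (Cons c cs)
  show ?case
    by (simp add: Cons.IH terms_value_scale sum.lessThan_Suc_shift mult.assoc sum_negf del: sum.lessThan_Suc)
qed simp

lemma det_power_mat:
  "length rs = length cs \<Longrightarrow> det (power_mat a rs cs) = terms_value a (minor_terms rs cs)"
proof (induction rs arbitrary: cs)
  case Nil
  then show ?case by (simp add: power_mat_def)
next
  case (Cons r rs)
  let ?n = "length cs"
  let ?A = "power_mat a (r # rs) cs"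
  have n: "?n = Suc (length rs)" using Cons.prems by simp
  have minor: "mat_delete ?A 0 j = power_mat a rs (take j cs @ drop (Suc j) cs)" if "j < ?n" for j
    using that n
    by (intro eq_matI) (auto simp: mat_delete_def power_mat_def nth_append min_def)
  have "?A \<in> carrier_mat ?n ?n" using n by (simp add: power_mat_def)
  then have "det ?A = (\<Sum>j<?n. ?A $$ (0, j) * cofactor ?A 0 j)"
    by (rule laplace_expansion_row) (simp add: n)
  also have "\<dots> = (\<Sum>j<?n. (- 1) ^ j * u ^ (a * r * cs ! j) *
      terms_value a (minor_terms rs (take j cs @ drop (Suc j) cs)))"
  proof (intro sum.cong refl)
    fix j assume "j \<in> {..<?n}"
    then have j: "j < ?n" by simp
    then have "det (mat_delete ?A 0 j) = terms_value a (minor_terms rs (take j cs @ drop (Suc j) cs))"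
      unfolding minor[OF j] using n by (intro Cons.IH) simp
    moreover have "?A $$ (0, j) = u ^ (a * r * cs ! j)" using j by (simp add: power_mat_def)
    ultimately show "?A $$ (0, j) * cofactor ?A 0 j = (- 1) ^ j * u ^ (a * r * cs ! j) *
        terms_value a (minor_terms rs (take j cs @ drop (Suc j) cs))"
      by (simp add: cofactor_def)
  qed
  finally show ?case by (simp add: terms_value_expand_row)
qed

text \<open>For \<open>k < 11\<close>, the coefficient of \<open>x ^ k\<close> after reduction
  modulo \<open>x ^ 11 - 1\<close>.\<close>

definition term_count :: "(int \<times> nat) list \<Rightarrow> nat \<Rightarrow> int" where
  "term_count ts k = (\<Sum>(s, e)\<leftarrow>ts. if e mod 11 = k then s else 0)"

text \<open>Multiplication by \<open>a\<close> permutes the exponents mod 11 and fixes 0, so the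
  coefficients \<open>d\<close> of the relation in \<open>u\<close> are the counts permuted.\<close>

lemma term_count_cong_if_terms_value_0:
  assumes zero: "terms_value a ts = 0" and a: "\<not> 11 dvd a" and k: "k < 11"
  shows "13 dvd term_count ts k - term_count ts 0"
proof -
  define d where "d m = (\<Sum>(s, e)\<leftarrow>ts. if (a * e) mod 11 = m then s else 0)" for m
  have "(\<Sum>m<11. of_int (\<Sum>(s, e)\<leftarrow>ts. if (a * e) mod 11 = m then s else 0) * u ^ m) = terms_value a ts" for ts
  proof (induction ts)
    case (Cons t ts)
    obtain s e where t: "t = (s, e)" by fastforce
    have "(\<Sum>m<11. of_int (if (a * e) mod 11 = m then s else 0) * u ^ m)
        = (\<Sum>m<11. if (a * e) mod 11 = m then of_int s * u ^ m else 0)"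
      by (intro sum.cong refl) simp
    also have "\<dots> = of_int s * u ^ ((a * e) mod 11)" by simp
    also have "u ^ ((a * e) mod 11) = u ^ (a * e)" by (rule u_pow_cong) (simp add: cong_def)
    finally show ?case
      using Cons.IH by (simp add: t distrib_right sum.distrib)
  qed simp
  then have rel: "(\<Sum>m<11. of_int (d m) * u ^ m) = 0" unfolding d_def by (simp only: zero)
  have "d ((a * j) mod 11) = term_count ts j" if "j < 11" for j
    using mult_mod_11_eq_iff[OF a, of _ 0 j] that unfolding d_def term_count_def by simp
  from this[OF k] this[of 0] show ?thesis
    using coeffs_cong_if_relation_u[OF rel, of "(a * k) mod 11"] by simp
qed

text \<open>
  Indices up to 7 suffice to tell the coefficients apart in all cases met below. The recursion uses
  a conditional because the simplifier then skips the indices after the first difference, which it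
  would still evaluate in a conjunction.
\<close>

fun counts_cong :: "(int \<times> nat) list \<Rightarrow> int \<Rightarrow> nat list \<Rightarrow> bool" where
  "counts_cong ts b [] = True"
| "counts_cong ts b (k # ks) = (if 13 dvd term_count ts k - b then counts_cong ts b ks else False)"

definition balanced :: "(int \<times> nat) list \<Rightarrow> bool" where
  "balanced ts \<longleftrightarrow> counts_cong ts (term_count ts 0) [1, 2, 3, 4, 5, 6, 7]"

section \<open>The finite check and the reduction to it\<close>

text \<open>At most three of the nine indices from 2 to 10 can be chosen in 1 + 9 + 36 + 84 = 130
  ways; each case is evaluated.\<close>

lemma unbalanced_minors:
  "\<forall>ys\<in>set (filter (\<lambda>ys. length ys \<le> 3) (subseqs [2..<11])).
    \<not> balanced (minor_terms (0 # 1 # ys) (0 # 1 # ys))"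
  by code_simp

text \<open>Singularity would make all counts congruent mod 13, against the computation.\<close>

lemma nonsingular_if_0_1:
  assumes T: "T \<subseteq> {..<11}" "0 \<in> T" "1 \<in> T" "card T \<le> 5" and a: "\<not> 11 dvd a"
  shows "\<not> singular_on a T"
proof
  assume sing: "singular_on a T"
  have "T - {0, 1} \<subseteq> set [2..<11]"
  proof
    fix t assume "t \<in> T - {0, 1}"
    then have "t < 11" "t \<noteq> 0" "t \<noteq> 1" using T(1) by auto
    then show "t \<in> set [2..<11]" unfolding set_upt atLeastLessThan_iff by linarith
  qed
  then obtain ys where ys: "ys \<in> set (subseqs [2..<11])" "set ys = T - {0, 1}"
    using subset_subseqs by (metis imageE)
  define xs where "xs = 0 # 1 # ys"
  have "distinct ys" using ys(1) by (rule subseqs_distinctD) simp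
  then have xs: "distinct xs" "set xs = T" using ys(2) T by (auto simp: xs_def)
  then have "length xs \<le> 5" using T(4) distinct_card by metis
  then have "length ys \<le> 3" by (simp add: xs_def)
  then have "ys \<in> set (filter (\<lambda>ys. length ys \<le> 3) (subseqs [2..<11]))"
    unfolding set_filter using ys(1) by blast
  then have "\<not> balanced (minor_terms xs xs)"
    unfolding xs_def by (rule bspec[OF unbalanced_minors])
  moreover have "terms_value a (minor_terms xs xs) = 0"
    using sing xs det_power_mat_eq_0_iff[of xs a] by (simp add: det_power_mat)
  then have "balanced (minor_terms xs xs)"
    using term_count_cong_if_terms_value_0[OF _ a] by (simp add: balanced_def)
  ultimately show False by simp
qed

text \<open>Affine maps mod 11 act doubly transitively: one of them sends 0 and 1 to two given
  elements of \<open>S\<close>, so the preimage of \<open>S\<close> contains 0 and 1.\<close>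

lemma nonsingular_if_card_le_5:
  assumes S: "S \<subseteq> {..<11}" "card S \<le> 5" and a: "\<not> 11 dvd a"
  shows "\<not> singular_on a S"
proof
  assume sing: "singular_on a S"
  then obtain v i where v: "i \<in> S" "v i \<noteq> 0"
      "\<And>i. i \<in> S \<Longrightarrow> (\<Sum>j\<in>S. u ^ (a * i * j) * v j) = 0"
    unfolding singular_on_def by blast
  \<comment> \<open>On a single index the sum is a power of \<open>u\<close> times
    \<open>v i\<close>, which is nonzero.\<close>
  have "S \<noteq> {i}" using v(2) v(3)[of i] u_nz by auto
  then obtain q where q: "q \<in> S" "q \<noteq> i" using v(1) by auto
  \<comment> \<open>This is \<open>q - i\<close> mod 11; adding 11 avoids truncated
    subtraction.\<close>
  define c where "c = q + 11 - i"
  have lt: "i < 11" "q < 11" using S v(1) q by auto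
  have c: "\<not> 11 dvd c"
  proof
    assume "11 dvd c"
    then have "(c + i) mod 11 = i mod 11" by (auto elim!: dvdE)
    then show False using lt q(2) by (simp add: c_def)
  qed
  define f where "f t = (c * t + i) mod 11" for t
  have inj: "inj_on f {..<11}"
    by (rule inj_onI) (use mult_mod_11_eq_iff[OF c] in \<open>simp add: f_def\<close>)
  have surj: "f ` {..<11} = {..<11}"
    by (rule endo_inj_surj[OF _ _ inj]) (auto simp: f_def)
  define T where "T = {t \<in> {..<11}. f t \<in> S}"
  have T: "S = f ` T" "T \<subseteq> {..<11}" using surj S by (auto simp: T_def)
  have "f 0 = i" "f 1 = q" using lt by (simp_all add: f_def c_def)
  then have "0 \<in> T" "1 \<in> T" using v(1) q(1) by (simp_all add: T_def)
  moreover have "card T = card S"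
    unfolding T(1) using inj_on_subset[OF inj T(2)] by (rule card_image[symmetric])
  moreover have "singular_on (a * c\<^sup>2) T"
    using T(1) unfolding f_def by (rule singular_on_affine_image) (fact T(2) c sing)+
  moreover have "\<not> 11 dvd a * c\<^sup>2"
    using a c by (simp add: prime_dvd_mult_iff prime_dvd_power_iff)
  ultimately show False using nonsingular_if_0_1 T(2) S(2) by metis
qed

theorem proposition3p2:
  fixes S :: "nat set"
  assumes "S \<subseteq> {0..10}"
  shows "det (submatrix W11 S S) \<noteq> 0"
proof
  assume "det (submatrix W11 S S) = 0"
  have S: "S \<subseteq> {..<11}" using assms by force
  then obtain xs where "distinct xs" "set xs = S" "submatrix W11 S S = power_mat 1 xs xs"
    by (rule submatrix_W11_eq_power_mat)
  with \<open>det (submatrix W11 S S) = 0\<close> have sing: "singular_on 1 S"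
    using det_power_mat_eq_0_iff by metis
  show False
  proof (cases "card S \<le> 5")
    case True
    then show False using nonsingular_if_card_le_5 S sing by fastforce
  next
    case False
    \<comment> \<open>At least six of the 11 indices lie in \<open>S\<close>, so at most five lie
      outside.\<close>
    have "card ({..<11} - S) = 11 - card S"
      using S by (simp add: card_Diff_subset finite_subset)
    with False have "card ({..<11} - S) \<le> 5" by linarith
    moreover have "singular_on (10 * 1) ({..<11} - S)"
      using sing S by (rule singular_on_compl) simp
    ultimately show False
      using nonsingular_if_card_le_5[of "{..<11} - S" "10 * 1"] by simp
  qed
qed

end
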